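(* Let $d,N\ge 1$ be integers and let $\kappa=(\nu,P,\tilde P,U)\in\mathcal K_d$, with $p,\tilde\theta,\tilde x,\mathbb I$ and the bilinear form $\langle\,,\,\rangle$ on $V$ as defined in the context. Then for all $n,m\in\mathbb I$, $$\langle\tilde x^n,\tilde x^m\rangle=\delta_{n,m}\frac{n!}{p^n}\tilde\theta^N.$$
   Context: $\mathcal K_d$ is the set of 4-tuples $(\nu,P,\tilde P,U)$ where $\nu$ is a nonzero complex number and $P,\tilde P,U$ are $(d+1)\times(d+1)$ complex matrices (rows and columns indexed by $0,\dots,d$) such that: (i) $P=\mathrm{diag}(p_0,\dots,p_d)$ and $\tilde P=\mathrm{diag}(\tilde p_0,\dots,\tilde p_d)$ with $p_0=\tilde p_0=1/\nu$; (ii) $U=(u_{i,j})_{0\le i,j\le d}$ with $u_{0,j}=u_{j,0}=1$ for all $j=0,\dots,d$; (iii) $\nu PU\tilde PU^t=I_{d+1}$. (All $p_j,\tilde p_j$ are then nonzero.) Write $p=(p_0,\dots,p_d)$, $\tilde p=(\tilde p_0,\dots,\tilde p_d)$. Let $\tilde\theta\in\mathbb C$ be such that the matrix $R=\tilde\theta\tilde PU^t$ has $\det R=1$, and let $\theta=\nu/\tilde\theta$. Let $x=(x_0,\dots,x_d)$ be commuting variables and define $\tilde x=(\tilde x_0,\dots,\tilde x_d)$ by the row-vector equation $\tilde x=xR$. Multi-index notation: for $\lambda\in\mathbb N_0^{d+1}$, $x^\lambda=\prod_{i=0}^d x_i^{\lambda_i}$, $\lambda!=\prod_{i=0}^d\lambda_i!$,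 $|\lambda|=\sum_{i=0}^d\lambda_i$ (similarly for $\tilde x^\lambda,p^\lambda,\tilde p^{\,\lambda}$). $\mathbb I=\{\lambda\in\mathbb N_0^{d+1}:|\lambda|=N\}$, and $V=\mathrm{span}_{\mathbb C}\{x^\lambda:\lambda\in\mathbb I\}$ is the space of homogeneous polynomials of total degree $N$ in $x_0,\dots,x_d$. The symmetric bilinear form $\langle\,,\,\rangle$ on $V$ is defined by $\langle x^n,x^m\rangle=\delta_{n,m}\frac{n!}{\tilde p^{\,n}}\theta^N$ for $n,m\in\mathbb I$. *)

theory Defs
  imports Complex_Main "HOL-Library.Poly_Mapping" "Jordan_Normal_Form.Determinant"
begin

(* Matrices of size d+1 are indexed by 0,...,d, as in Jordan_Normal_Form. *)

definition kappa_tuples :: "nat \<Rightarrow> (complex \<times> complex mat \<times> complex mat \<times> complex mat) set" where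
  "kappa_tuples d = {(\<nu>, P, Pt, U).
     \<nu> \<noteq> 0 \<and>
     P \<in> carrier_mat (Suc d) (Suc d) \<and> Pt \<in> carrier_mat (Suc d) (Suc d) \<and>
     U \<in> carrier_mat (Suc d) (Suc d) \<and>
     diagonal_mat P \<and> diagonal_mat Pt \<and>
     P $$ (0, 0) = 1 / \<nu> \<and> Pt $$ (0, 0) = 1 / \<nu> \<and>
     (\<forall>j\<le>d. U $$ (0, j) = 1 \<and> U $$ (j, 0) = 1) \<and>
     \<nu> \<cdot>\<^sub>m (P * U * Pt * transpose_mat U) = 1\<^sub>m (Suc d)}"

type_synonym multi_index = "nat \<Rightarrow>\<^sub>0 nat"

(* Complex polynomials in x_0, x_1, ...; the coefficient of x^l in f is Poly_Mapping.lookup f l. *)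
type_synonym cpoly = "(nat \<Rightarrow>\<^sub>0 nat) \<Rightarrow>\<^sub>0 complex"

definition const :: "complex \<Rightarrow> cpoly" where
  "const c = Poly_Mapping.single 0 c"

definition var :: "nat \<Rightarrow> cpoly" where
  "var i = Poly_Mapping.single (Poly_Mapping.single i 1) 1"

definition multi_indices :: "nat \<Rightarrow> nat \<Rightarrow> multi_index set" where
  "multi_indices d N = {l. Poly_Mapping.keys l \<subseteq> {..d} \<and> (\<Sum>i\<le>d. Poly_Mapping.lookup l i) = N}"

definition mpow :: "nat \<Rightarrow> (nat \<Rightarrow> 'a::comm_monoid_mult) \<Rightarrow> multi_index \<Rightarrow> 'a" where
  "mpow d a l = (\<Prod>i\<le>d. a i ^ Poly_Mapping.lookup l i)"

definition mfact :: "nat \<Rightarrow> multi_index \<Rightarrow> complex" where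
  "mfact d l = (\<Prod>i\<le>d. fact (Poly_Mapping.lookup l i))"

definition scale :: "complex \<Rightarrow> cpoly \<Rightarrow> cpoly" where
  "scale c f = const c * f"

definition hom_polys :: "nat \<Rightarrow> nat \<Rightarrow> cpoly set" where
  "hom_polys d N = module.span scale (mpow d var ` multi_indices d N)"

(* The entries of the row vector (x_0,...,x_d) R. *)
definition row_transform :: "nat \<Rightarrow> complex mat \<Rightarrow> nat \<Rightarrow> cpoly" where
  "row_transform d R j = (\<Sum>i\<le>d. var i * const (R $$ (i, j)))"

definition form_on_monomials ::
    "nat \<Rightarrow> nat \<Rightarrow> (nat \<Rightarrow> complex) \<Rightarrow> complex \<Rightarrow> multi_index \<Rightarrow> multi_index \<Rightarrow> complex" where
  "form_on_monomials d N q \<theta> n m = (if n = m then mfact d n / mpow d q n * \<theta> ^ N else 0)"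

(* The bilinear extension of form_on_monomials to hom_polys d N; see form_monomials,
   form_add_left, form_scale_left, form_sym and form_unique below.
   Coefficients outside multi_indices d N are ignored; mpow_row_transform_hom shows that
   the polynomials it is applied to lie in hom_polys d N. *)
definition form ::
    "nat \<Rightarrow> nat \<Rightarrow> (nat \<Rightarrow> complex) \<Rightarrow> complex \<Rightarrow> cpoly \<Rightarrow> cpoly \<Rightarrow> complex" where
  "form d N q \<theta> f g =
     (\<Sum>n\<in>multi_indices d N. \<Sum>m\<in>multi_indices d N.
        Poly_Mapping.lookup f n * Poly_Mapping.lookup g m * form_on_monomials d N q \<theta> n m)"

lemma scale_vector_space: "vector_space scale"
  by unfold_locales
    (simp_all add: scale_def const_def algebra_simps single_add mult_single flip: single_one)

interpretation cpoly: vector_space scale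
  by (rule scale_vector_space)

lemma lookup_scale: "Poly_Mapping.lookup (scale c f) l = c * Poly_Mapping.lookup f l"
proof -
  have "scale c f = Poly_Mapping.map ((*) c) f"
    by (simp add: scale_def const_def mult_map_scale_conv_mult)
  thus ?thesis
    by (simp add: Poly_Mapping.map.rep_eq when_def)
qed

lemma mpow_var:
  assumes "Poly_Mapping.keys l \<subseteq> {..d}"
  shows "mpow d var l = Poly_Mapping.single l 1"
proof -
  have pow: "var i ^ k = Poly_Mapping.single (Poly_Mapping.single i k) 1" for i k
    by (induction k) (simp_all add: var_def mult_single single_add[symmetric])
  have prod: "(\<Prod>i\<in>A. Poly_Mapping.single (g i) (1::complex)) = Poly_Mapping.single (\<Sum>i\<in>A. g i) 1"
    if "finite A" for A and g :: "nat \<Rightarrow> multi_index"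
    using that by induction (simp_all add: mult_single)
  have "(\<Sum>i\<le>d. Poly_Mapping.single i (Poly_Mapping.lookup l i)) = l"
  proof (rule poly_mapping_eqI)
    fix k
    have "Poly_Mapping.lookup (\<Sum>i\<le>d. Poly_Mapping.single i (Poly_Mapping.lookup l i)) k
        = (\<Sum>i\<le>d. if i = k then Poly_Mapping.lookup l i else 0)"
      by (simp add: lookup_sum lookup_single when_def)
    also have "\<dots> = Poly_Mapping.lookup l k"
      using assms by (auto simp: sum.delta in_keys_iff subset_iff)
    finally show "Poly_Mapping.lookup (\<Sum>i\<le>d. Poly_Mapping.single i (Poly_Mapping.lookup l i)) k = Poly_Mapping.lookup l k" .
  qed
  thus ?thesis
    by (simp add: mpow_def pow prod)
qed

lemma finite_multi_indices: "finite (multi_indices d N)"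
proof -
  have "Poly_Mapping.lookup l \<in> {f. (\<forall>x. x \<in> {..d} \<longrightarrow> f x \<in> {..N}) \<and> (\<forall>x. x \<notin> {..d} \<longrightarrow> f x = 0)}"
    if "l \<in> multi_indices d N" for l
  proof -
    have "Poly_Mapping.lookup l i \<le> N" if "i \<le> d" for i
      using member_le_sum[of i "{..d}" "Poly_Mapping.lookup l"] that \<open>l \<in> multi_indices d N\<close>
      by (auto simp: multi_indices_def)
    thus ?thesis
      using that by (auto simp: multi_indices_def in_keys_iff subset_iff)
  qed
  hence "finite (Poly_Mapping.lookup ` multi_indices d N)"
    by (intro finite_subset[OF _ finite_set_of_finite_funs[of "{..d}" "{..N}" 0]]) auto
  thus ?thesis
    by (rule finite_imageD) (simp add: inj_on_def lookup_inject)
qed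

lemma form_monomials:
  assumes "n \<in> multi_indices d N" "m \<in> multi_indices d N"
  shows "form d N q \<theta> (mpow d var n) (mpow d var m)
       = (if n = m then mfact d n / mpow d q n * \<theta> ^ N else 0)"
proof -
  have eq: "mpow d var n = Poly_Mapping.single n 1" "mpow d var m = Poly_Mapping.single m 1"
    using assms by (auto simp: multi_indices_def mpow_var)
  have "form d N q \<theta> (mpow d var n) (mpow d var m)
      = (\<Sum>n'\<in>multi_indices d N. if n' = n then
          (\<Sum>m'\<in>multi_indices d N. if m' = m then form_on_monomials d N q \<theta> n' m' else 0) else 0)"
    unfolding form_def eq by (intro sum.cong) (auto simp: lookup_single when_def intro!: sum.cong)
  thus ?thesis
    using assms finite_multi_indices by (simp add: form_on_monomials_def)
qed

lemma form_sym: "form d N q \<theta> f g = form d N q \<theta> g f"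
  unfolding form_def
  by (subst sum.swap) (intro sum.cong refl, auto simp: form_on_monomials_def)

lemma form_add_left: "form d N q \<theta> (f + f') g = form d N q \<theta> f g + form d N q \<theta> f' g"
  by (simp add: form_def lookup_add algebra_simps sum.distrib)

lemma form_scale_left: "form d N q \<theta> (scale c f) g = c * form d N q \<theta> f g"
  by (simp add: form_def lookup_scale sum_distrib_left mult.assoc)

lemma form_unique:
  fixes B :: "cpoly \<Rightarrow> cpoly \<Rightarrow> complex"
  assumes add: "\<And>f f' g. \<lbrakk>f \<in> hom_polys d N; f' \<in> hom_polys d N; g \<in> hom_polys d N\<rbrakk>
                  \<Longrightarrow> B (f + f') g = B f g + B f' g"
    and scale: "\<And>c f g. \<lbrakk>f \<in> hom_polys d N; g \<in> hom_polys d N\<rbrakk> \<Longrightarrow> B (scale c f) g = c * B f g"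
    and sym: "\<And>f g. \<lbrakk>f \<in> hom_polys d N; g \<in> hom_polys d N\<rbrakk> \<Longrightarrow> B f g = B g f"
    and mono: "\<And>n m. \<lbrakk>n \<in> multi_indices d N; m \<in> multi_indices d N\<rbrakk>
      \<Longrightarrow> B (mpow d var n) (mpow d var m) = (if n = m then mfact d n / mpow d q n * \<theta> ^ N else 0)"
    and fg: "f \<in> hom_polys d N" "g \<in> hom_polys d N"
  shows "B f g = form d N q \<theta> f g"
proof -
  let ?S = "mpow d var ` multi_indices d N"
  note V = hom_polys_def
  have zero: "B 0 h = 0" "form d N q \<theta> 0 h = 0" if "h \<in> hom_polys d N" for h
    using scale[of 0 h 0] form_scale_left[of d N q \<theta> 0 0 h] that
    by (auto simp: V cpoly.span_zero)
  have ext: "B f h = form d N q \<theta> f h"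
    if f: "f \<in> hom_polys d N" and h: "h \<in> hom_polys d N"
      and gen: "\<And>s. s \<in> ?S \<Longrightarrow> B s h = form d N q \<theta> s h" for f h
  proof -
    have "f \<in> cpoly.span ?S" using f by (simp add: V)
    hence "f \<in> hom_polys d N \<and> B f h = form d N q \<theta> f h"
    proof (induction rule: cpoly.span_induct_alt)
      case base
      show ?case using zero h by (simp add: V cpoly.span_zero)
    next
      case (step c s y)
      have "s \<in> hom_polys d N" "scale c s \<in> hom_polys d N" "scale c s + y \<in> hom_polys d N"
        using step by (auto simp: V intro: cpoly.span_base cpoly.span_scale cpoly.span_add)
      thus ?case
        using step h gen by (simp add: add scale form_add_left form_scale_left)
    qed
    thus ?thesis ..
  qed
  have S: "s \<in> hom_polys d N" if "s \<in> ?S" for s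
    using that unfolding V by (rule cpoly.span_base)
  show ?thesis
  proof (rule ext[OF fg])
    fix s assume s: "s \<in> ?S"
    have "B g s = form d N q \<theta> g s"
    proof (rule ext[OF fg(2) S[OF s]])
      fix t assume "t \<in> ?S"
      with s show "B t s = form d N q \<theta> t s"
        using mono by (auto simp: form_monomials)
    qed
    thus "B s g = form d N q \<theta> s g"
      using sym[OF S[OF s] fg(2)] by (simp add: form_sym)
  qed
qed

lemma mult_hom_polys:
  assumes "f \<in> hom_polys d a" "g \<in> hom_polys d b"
  shows "f * g \<in> hom_polys d (a + b)"
proof -
  note V = hom_polys_def
  have scale_mult: "scale c f * g = scale c (f * g)" "f * scale c g = scale c (f * g)" for c f g
    by (simp_all add: scale_def algebra_simps)
  have mono: "mpow d var n * mpow d var m \<in> hom_polys d (a + b)"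
    if "n \<in> multi_indices d a" "m \<in> multi_indices d b" for n m
  proof -
    have "mpow d var n * mpow d var m = mpow d var (n + m)"
      by (simp add: mpow_def lookup_add power_add prod.distrib)
    moreover have "n + m \<in> multi_indices d (a + b)"
      using that keys_add[of n m] by (auto simp: multi_indices_def lookup_add sum.distrib)
    ultimately show ?thesis
      unfolding V by (auto intro: cpoly.span_base)
  qed
  have left: "f * mpow d var m \<in> hom_polys d (a + b)" if m: "m \<in> multi_indices d b" for m
    using assms(1) unfolding V[of d a]
  proof (induction rule: cpoly.span_induct_alt)
    case base
    show ?case by (simp add: V cpoly.span_zero)
  next
    case (step c s y)
    thus ?case using mono m
      by (auto simp: V distrib_right scale_mult intro!: cpoly.span_add cpoly.span_scale)
  qed
  show ?thesis
    using assms(2) unfolding V[of d b]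
  proof (induction rule: cpoly.span_induct_alt)
    case base
    show ?case by (simp add: V cpoly.span_zero)
  next
    case (step c s y)
    thus ?case using left
      by (auto simp: V distrib_left scale_mult intro!: cpoly.span_add cpoly.span_scale)
  qed
qed

lemma row_transform_hom: "row_transform d R j \<in> hom_polys d 1"
proof -
  have "var i \<in> hom_polys d 1" if "i \<le> d" for i
  proof -
    let ?e = "Poly_Mapping.single i 1 :: multi_index"
    have "?e \<in> multi_indices d 1"
      using that by (simp add: multi_indices_def lookup_single when_def)
    moreover from this have "var i = mpow d var ?e"
      by (simp only: multi_indices_def mem_Collect_eq mpow_var var_def)
    ultimately show ?thesis
      unfolding hom_polys_def by (metis cpoly.span_base image_eqI)
  qed
  moreover have "var i * const c = scale c (var i)" for i c
    by (simp add: scale_def mult.commute)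
  ultimately show ?thesis
    by (auto simp: row_transform_def hom_polys_def intro!: cpoly.span_sum cpoly.span_scale)
qed

lemma mpow_row_transform_hom:
  assumes "n \<in> multi_indices d N"
  shows "mpow d (row_transform d R) n \<in> hom_polys d N"
proof -
  have one: "1 \<in> hom_polys d 0"
  proof -
    have "0 \<in> multi_indices d 0" "mpow d var 0 = 1"
      by (simp_all add: multi_indices_def mpow_def)
    thus ?thesis
      unfolding hom_polys_def by (metis cpoly.span_base image_eqI)
  qed
  have pow: "row_transform d R j ^ k \<in> hom_polys d k" for j k
    using one mult_hom_polys[OF row_transform_hom] by (induction k) simp_all
  have "(\<Prod>i\<in>A. row_transform d R i ^ g i) \<in> hom_polys d (\<Sum>i\<in>A. g i)"
    if "finite A" for A g
    using that by induction (simp_all add: one pow mult_hom_polys)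
  thus ?thesis
    using assms by (auto simp: mpow_def multi_indices_def)
qed

end

theory Submission
  imports Defs
begin

text \<open>
  Multiplication by \<open>x\<^sub>i\<close> is adjoint, up to the factor \<open>\<theta> / q\<^sub>i\<close>, to the partial derivative
  \<open>\<partial>\<^sub>i\<close>. Hence multiplication by a linear form is adjoint to a directional derivative, which acts on
  the other linear forms by the degree-one Gram matrix. For \<open>\<kappa> \<in> \<K>\<^sub>d\<close> the relation
  \<open>\<nu> P U Pt U\<^sup>t = I\<close> says that this Gram matrix is diagonal, so the directional derivative attached
  to the \<open>i\<close>-th new variable is a multiple of the partial derivative in that variable, and the
  claim follows by induction on the degree.
\<close>

section \<open>Constants and multi-index arithmetic\<close>

lemma lookup_const_mult: "Poly_Mapping.lookup (const c * f) l = c * Poly_Mapping.lookup f l"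
  using lookup_scale[of c f l] by (simp add: scale_def)

lemma const_0: "const 0 = 0"
  by (simp add: const_def)

lemma const_mult: "const (a * b) = const a * const b"
  by (simp add: const_def mult_single)

lemma const_sum: "const (sum f A) = (\<Sum>i\<in>A. const (f i))"
  by (induction A rule: infinite_finite_induct) (simp_all add: const_def single_add)

lemma multi_index_minus_single_add:
  fixes l :: multi_index
  assumes "Poly_Mapping.lookup l i > 0"
  shows "l - Poly_Mapping.single i 1 + Poly_Mapping.single i 1 = l"
  by (rule poly_mapping_eqI) (use assms in \<open>auto simp: lookup_add lookup_minus lookup_single when_def\<close>)

lemma add_single_in_multi_indices_iff:
  assumes "i \<le> d"
  shows "l + Poly_Mapping.single i 1 \<in> multi_indices d (Suc N) \<longleftrightarrow> l \<in> multi_indices d N"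
proof -
  have "Poly_Mapping.keys (l + Poly_Mapping.single i 1) = insert i (Poly_Mapping.keys l)"
    by (auto simp: in_keys_iff lookup_add lookup_single when_def split: if_splits)
  moreover have "(\<Sum>j\<le>d. Poly_Mapping.lookup (l + Poly_Mapping.single i 1) j)
      = Suc (\<Sum>j\<le>d. Poly_Mapping.lookup l j)"
    using assms by (simp add: lookup_add sum.distrib lookup_single when_def)
  ultimately show ?thesis
    using assms by (simp add: multi_indices_def)
qed

text \<open>Peels one variable off a monomial of positive degree; both inductions on the degree use
  this.\<close>

lemma multi_indices_SucE:
  assumes "m \<in> multi_indices d (Suc N)"
  obtains i m' where "i \<le> d" "m' \<in> multi_indices d N" "m = m' + Poly_Mapping.single i 1"
proof -
  have "(\<Sum>i\<le>d. Poly_Mapping.lookup m i) \<noteq> 0"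
    using assms by (simp add: multi_indices_def)
  then obtain i where i: "i \<le> d" "Poly_Mapping.lookup m i > 0"
    by auto
  have "m - Poly_Mapping.single i 1 \<in> multi_indices d N"
    using assms i add_single_in_multi_indices_iff[of i d "m - Poly_Mapping.single i 1" N]
    by (simp only: multi_index_minus_single_add)
  thus thesis
    using that i multi_index_minus_single_add[of m i] by metis
qed

lemma multi_indices_0: "multi_indices d 0 = {0}"
  by (auto simp: multi_indices_def subset_iff in_keys_iff intro!: poly_mapping_eqI)

lemma mpow_add_single:
  assumes "i \<le> d"
  shows "mpow d a (l + Poly_Mapping.single i 1) = a i * mpow d a l"
proof -
  have "(\<Prod>j\<le>d. a j ^ (if i = j then Suc 0 else 0)) = (\<Prod>j\<le>d. if j = i then a j else 1)"
    by (rule prod.cong) auto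
  thus ?thesis
    using assms by (simp add: mpow_def lookup_add power_add prod.distrib lookup_single when_def
        mult.commute)
qed

lemma mfact_add_single:
  assumes "i \<le> d"
  shows "mfact d (l + Poly_Mapping.single i 1) = of_nat (Suc (Poly_Mapping.lookup l i)) * mfact d l"
proof -
  have "(\<Prod>j\<le>d. (fact (Poly_Mapping.lookup (l + Poly_Mapping.single i 1) j) :: complex))
     = (\<Prod>j\<le>d. (if j = i then of_nat (Suc (Poly_Mapping.lookup l i)) else 1)
          * fact (Poly_Mapping.lookup l j))"
    by (rule prod.cong) (auto simp: lookup_add lookup_single when_def)
  thus ?thesis
    using assms by (simp add: mfact_def prod.distrib)
qed

section \<open>Multiplication by a variable and formal partial derivatives\<close>

lemma lookup_var_mult:
  "Poly_Mapping.lookup (var i * f) l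
    = (if Poly_Mapping.lookup l i > 0 then Poly_Mapping.lookup f (l - Poly_Mapping.single i 1) else 0)"
proof -
  have "Poly_Mapping.lookup (var i * f) l
      = (\<Sum>k. (\<Sum>q. Poly_Mapping.lookup f q when l = k + q) when k = Poly_Mapping.single i 1)"
    unfolding lookup_mult var_def by (rule Sum_any.cong) (auto simp: lookup_single when_def)
  also have "\<dots> = (\<Sum>q. Poly_Mapping.lookup f q when l = Poly_Mapping.single i 1 + q)"
    by simp
  also have "\<dots> = (if Poly_Mapping.lookup l i > 0
      then Poly_Mapping.lookup f (l - Poly_Mapping.single i 1) else 0)"
  proof (cases "Poly_Mapping.lookup l i > 0")
    case True
    hence "l = Poly_Mapping.single i 1 + q \<longleftrightarrow> q = l - Poly_Mapping.single i 1" for q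
      using multi_index_minus_single_add[of l i] by (auto simp: add.commute)
    thus ?thesis
      using True by simp
  next
    case False
    hence "l \<noteq> Poly_Mapping.single i 1 + q" for q
      by (auto simp: lookup_add)
    thus ?thesis
      using False by simp
  qed
  finally show ?thesis .
qed

text \<open>The formal derivative in \<open>x_k\<close>, encoded by coefficients because
  \<open>form\<close> sees polynomials only through their coefficients.\<close>

lift_definition partial :: "nat \<Rightarrow> cpoly \<Rightarrow> cpoly" is
  "\<lambda>k f l. of_nat (Suc (Poly_Mapping.lookup l k)) * f (l + Poly_Mapping.single k 1)"
proof -
  fix k :: nat and f :: "multi_index \<Rightarrow> complex"
  assume fin: "finite {l. f l \<noteq> 0}"
  \<comment> \<open>The support of the derivative lies in the preimage of the support of
    \<open>f\<close> under an injective shift.\<close>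
  have "finite ((\<lambda>l. l + Poly_Mapping.single k 1) -` {l. f l \<noteq> 0})"
    using fin by (rule finite_vimageI) (simp add: inj_on_def)
  thus "finite {l. of_nat (Suc (Poly_Mapping.lookup l k)) * f (l + Poly_Mapping.single k 1) \<noteq> 0}"
    by (rule rev_finite_subset) auto
qed

lemma partial_sum: "partial k (sum f A) = (\<Sum>i\<in>A. partial k (f i))"
  by (rule poly_mapping_eqI) (simp add: partial.rep_eq lookup_sum sum_distrib_left)

lemma partial_const_mult: "partial k (const c * f) = const c * partial k f"
  by (rule poly_mapping_eqI) (simp add: partial.rep_eq lookup_const_mult)

text \<open>The Leibniz rule with a single variable as factor; linear forms follow by
  linearity.\<close>

lemma partial_var_mult:
  "partial k (var i * f) = (if i = k then f else 0) + var i * partial k f"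
proof (rule poly_mapping_eqI)
  fix l
  show "Poly_Mapping.lookup (partial k (var i * f)) l
    = Poly_Mapping.lookup ((if i = k then f else 0) + var i * partial k f) l"
  proof (cases "i = k")
    case True
    then show ?thesis
      using multi_index_minus_single_add[of l k]
      by (auto simp: partial.rep_eq lookup_add lookup_var_mult lookup_minus of_nat_diff ring_distribs)
  next
    case False
    \<comment> \<open>Truncated subtraction at \<open>i\<close> and addition at \<open>k\<close>
      touch different exponents, so they commute.\<close>
    have "l + Poly_Mapping.single k 1 - Poly_Mapping.single i 1
        = l - Poly_Mapping.single i 1 + Poly_Mapping.single k 1"
      by (rule poly_mapping_eqI)
        (use False in \<open>auto simp: lookup_add lookup_minus lookup_single when_def\<close>)
    with False show ?thesis
      by (simp add: partial.rep_eq lookup_add lookup_var_mult lookup_minus lookup_single)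
  qed
qed

section \<open>Linear forms and derivatives in constant directions\<close>

lemma row_transform_mult:
  "row_transform d R j * f = (\<Sum>i\<le>d. const (R $$ (i, j)) * (var i * f))"
  unfolding row_transform_def sum_distrib_right by (intro sum.cong) (simp_all add: ac_simps)

lemma partial_row_transform_mult:
  assumes "k \<le> d"
  shows "partial k (row_transform d R j * f)
    = const (R $$ (k, j)) * f + row_transform d R j * partial k f"
proof -
  have "(\<Sum>i\<le>d. const (R $$ (i, j)) * (if i = k then f else 0))
      = (\<Sum>i\<le>d. if i = k then const (R $$ (i, j)) * f else 0)"
    by (intro sum.cong) simp_all
  thus ?thesis
    using assms by (simp add: row_transform_mult partial_sum partial_const_mult partial_var_mult
        distrib_left sum.distrib)
qed

definition dir_deriv :: "nat \<Rightarrow> (nat \<Rightarrow> complex) \<Rightarrow> cpoly \<Rightarrow> cpoly" where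
  "dir_deriv d c f = (\<Sum>k\<le>d. const (c k) * partial k f)"

lemma dir_deriv_row_transform_mult:
  "dir_deriv d c (row_transform d R j * f)
    = const (\<Sum>k\<le>d. c k * R $$ (k, j)) * f + row_transform d R j * dir_deriv d c f"
proof -
  have "dir_deriv d c (row_transform d R j * f)
      = (\<Sum>k\<le>d. const (c k * R $$ (k, j)) * f + row_transform d R j * (const (c k) * partial k f))"
    unfolding dir_deriv_def
    by (intro sum.cong) (simp_all add: partial_row_transform_mult const_mult distrib_left
        mult.assoc mult.left_commute)
  thus ?thesis
    by (simp add: sum.distrib const_sum sum_distrib_left sum_distrib_right dir_deriv_def)
qed

text \<open>By \<open>dual\<close>, the direction \<open>c\<close> annihilates every new variable
  except the \<open>i\<close>-th, whose derivative is \<open>a\<close>; so it acts as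
  \<open>a\<close> times the partial derivative in that variable. If the exponent of
  \<open>i\<close> is 0, truncated subtraction leaves \<open>m\<close> unchanged, but the
  coefficient is then 0.\<close>

lemma dir_deriv_mpow_row_transform:
  assumes dual: "\<And>j. j \<le> d \<Longrightarrow> (\<Sum>k\<le>d. c k * R $$ (k, j)) = (if j = i then a else 0)"
    and "m \<in> multi_indices d N"
  shows "dir_deriv d c (mpow d (row_transform d R) m)
    = const (of_nat (Poly_Mapping.lookup m i) * a)
        * mpow d (row_transform d R) (m - Poly_Mapping.single i 1)"
  using assms(2)
proof (induction N arbitrary: m)
  case 0
  have "partial k 1 = 0" for k
    proof (rule poly_mapping_eqI)
    fix l :: multi_index
    have "Poly_Mapping.lookup (l + Poly_Mapping.single k 1) k \<noteq> 0"
      by (simp add: lookup_add)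
    hence "l + Poly_Mapping.single k 1 \<noteq> 0"
      by auto
    thus "Poly_Mapping.lookup (partial k 1) l = Poly_Mapping.lookup 0 l"
      by (simp add: partial.rep_eq lookup_one)
  qed
  thus ?case
    using 0 by (simp add: multi_indices_0 mpow_def dir_deriv_def const_0)
next
  case (Suc N)
  let ?x = "row_transform d R"
  obtain j m' where j: "j \<le> d" "m' \<in> multi_indices d N" "m = m' + Poly_Mapping.single j 1"
    using Suc.prems by (rule multi_indices_SucE)
  have shift: "?x j * mpow d ?x (m' - Poly_Mapping.single i 1)
      = mpow d ?x (m' - Poly_Mapping.single i 1 + Poly_Mapping.single j 1)"
    by (rule mpow_add_single[OF j(1), symmetric])
  \<comment> \<open>Leibniz rule for the peeled factor: the first summand differentiates it, the
    second multiplies the induction hypothesis by it.\<close>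
  have *: "dir_deriv d c (mpow d ?x m) = const (if j = i then a else 0) * mpow d ?x m'
      + const (of_nat (Poly_Mapping.lookup m' i) * a)
        * mpow d ?x (m' - Poly_Mapping.single i 1 + Poly_Mapping.single j 1)"
    using j dual[of j] Suc.IH[of m'] shift
    by (simp only: mpow_add_single dir_deriv_row_transform_mult mult.left_commute)
  show ?case
  \<comment> \<open>If \<open>i\<close> occurs in \<open>m'\<close>, lowering \<open>i\<close> and
    raising \<open>j\<close> may be interchanged; otherwise the second summand has coefficient
    0.\<close>
  proof (cases "Poly_Mapping.lookup m' i = 0")
    case True
    then show ?thesis
      using * j by (auto simp: lookup_add lookup_single when_def const_0)
  next
    case False
    hence "m' - Poly_Mapping.single i 1 + Poly_Mapping.single j 1 = m - Poly_Mapping.single i 1"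
      unfolding j(3) by (intro poly_mapping_eqI) (auto simp: lookup_add lookup_minus lookup_single when_def)
    moreover have "m' = m - Poly_Mapping.single i 1" if "j = i"
      using that j by simp
    ultimately show ?thesis
      using * j by (auto simp: lookup_add lookup_single when_def const_def single_add algebra_simps)
  qed
qed

section \<open>Adjointness of multiplication and differentiation\<close>

lemma form_diagonal:
  "form d N q \<theta> f g = (\<Sum>n\<in>multi_indices d N.
     Poly_Mapping.lookup f n * Poly_Mapping.lookup g n * (mfact d n / mpow d q n * \<theta> ^ N))"
  by (simp add: form_def form_on_monomials_def finite_multi_indices if_distrib cong: if_cong)

lemma form_sum_left: "form d N q \<theta> (sum f A) g = (\<Sum>i\<in>A. form d N q \<theta> (f i) g)"
  unfolding form_diagonal lookup_sum sum_distrib_right by (rule sum.swap)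

lemma form_const_mult_left: "form d N q \<theta> (const c * f) g = c * form d N q \<theta> f g"
  using form_scale_left by (simp add: scale_def)

lemma form_sum_right: "form d N q \<theta> f (sum g A) = (\<Sum>i\<in>A. form d N q \<theta> f (g i))"
  by (simp add: form_sym[of _ _ _ _ f] form_sum_left)

lemma form_const_mult_right: "form d N q \<theta> f (const c * g) = c * form d N q \<theta> f g"
  by (simp add: form_sym[of _ _ _ _ f] form_const_mult_left)

text \<open>Raising the exponent \<open>l_i\<close> by one multiplies the weight of a monomial by
  \<open>(l_i + 1) * \<theta> / q i\<close>, and \<open>l_i + 1\<close> is the factor produced by
  \<open>partial i\<close>. For \<open>q i = 0\<close> both sides are 0, since division by 0 gives
  0.\<close>

lemma form_var_mult:
  assumes i: "i \<le> d"
  shows "form d (Suc N) q \<theta> (var i * f) g = \<theta> / q i * form d N q \<theta> f (partial i g)"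
proof -
  let ?s = "\<lambda>l. l + Poly_Mapping.single i 1 :: multi_index"
  let ?t = "\<lambda>n. Poly_Mapping.lookup (var i * f) n * Poly_Mapping.lookup g n
    * (mfact d n / mpow d q n * \<theta> ^ Suc N)"
  have "n \<in> ?s ` multi_indices d N"
    if "n \<in> multi_indices d (Suc N)" "Poly_Mapping.lookup n i > 0" for n
    using that i add_single_in_multi_indices_iff[of i d "n - Poly_Mapping.single i 1" N]
      multi_index_minus_single_add[of n i] by (metis image_eqI)
  \<comment> \<open>Only monomials divisible by \<open>x_i\<close> occur in
    \<open>var i * f\<close>; their indices are shifts of those of degree \<open>N\<close>.\<close>
  hence "(\<Sum>n\<in>multi_indices d (Suc N). ?t n) = (\<Sum>n\<in>?s ` multi_indices d N. ?t n)"
    using i by (intro sum.mono_neutral_right)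
      (auto simp: finite_multi_indices lookup_var_mult add_single_in_multi_indices_iff[simplified])
  also have "\<dots> = (\<Sum>l\<in>multi_indices d N. ?t (?s l))"
    by (simp add: sum.reindex inj_on_def)
  also have "\<dots> = \<theta> / q i * form d N q \<theta> f (partial i g)"
    unfolding form_diagonal sum_distrib_left
    by (intro sum.cong refl, subst mfact_add_single[OF i], subst mpow_add_single[OF i])
      (simp add: lookup_var_mult lookup_add partial.rep_eq divide_simps)
  finally show ?thesis
    by (simp only: form_diagonal)
qed

lemma form_row_transform_mult:
  "form d (Suc N) q \<theta> (row_transform d R i * f) g
    = form d N q \<theta> f (dir_deriv d (\<lambda>k. \<theta> / q k * R $$ (k, i)) g)"
  unfolding row_transform_mult dir_deriv_def form_sum_left form_sum_right
  by (intro sum.cong) (simp_all add: form_const_mult_left form_const_mult_right form_var_mult)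

text \<open>The hypothesis \<open>gram\<close> is the case of degree one. In the induction a new
  variable is peeled off the left argument and moved to the right one, where by \<open>gram\<close>
  it acts as \<open>s / p i\<close> times the derivative in the \<open>i\<close>-th new
  variable.\<close>

lemma form_mpow_row_transform:
  assumes gram: "\<And>i j. i \<le> d \<Longrightarrow> j \<le> d \<Longrightarrow>
      (\<Sum>k\<le>d. \<theta> / q k * R $$ (k, i) * R $$ (k, j)) = (if j = i then s / p i else 0)"
    and "n \<in> multi_indices d N" "m \<in> multi_indices d N"
  shows "form d N q \<theta> (mpow d (row_transform d R) n) (mpow d (row_transform d R) m)
       = form_on_monomials d N p s n m"
  using assms(2,3)
proof (induction N arbitrary: n m)
  case 0
  thus ?case
    by (simp add: multi_indices_0 form_diagonal form_on_monomials_def mpow_def lookup_one)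
next
  case (Suc N)
  let ?x = "row_transform d R"
  obtain i n' where i: "i \<le> d" "n' \<in> multi_indices d N" "n = n' + Poly_Mapping.single i 1"
    using Suc.prems(1) by (rule multi_indices_SucE)
  have "form d (Suc N) q \<theta> (mpow d ?x n) (mpow d ?x m)
      = form d N q \<theta> (mpow d ?x n') (dir_deriv d (\<lambda>k. \<theta> / q k * R $$ (k, i)) (mpow d ?x m))"
    by (simp only: i(3) mpow_add_single[OF i(1)] form_row_transform_mult)
  also have "\<dots> = of_nat (Poly_Mapping.lookup m i) * (s / p i)
      * form d N q \<theta> (mpow d ?x n') (mpow d ?x (m - Poly_Mapping.single i 1))"
    using dir_deriv_mpow_row_transform[OF gram[OF i(1)] Suc.prems(2)]
    by (simp only: form_const_mult_right)
  finally have *: "form d (Suc N) q \<theta> (mpow d ?x n) (mpow d ?x m) = \<dots>" .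
  show ?case
  proof (cases "Poly_Mapping.lookup m i > 0")
    case True
    define m' where "m' = m - Poly_Mapping.single i 1"
    have m: "m = m' + Poly_Mapping.single i 1"
      using True by (simp only: m'_def multi_index_minus_single_add)
    hence "m' \<in> multi_indices d N"
      using Suc.prems(2) add_single_in_multi_indices_iff[OF i(1)] by simp
    hence "form d (Suc N) q \<theta> (mpow d ?x n) (mpow d ?x m)
        = of_nat (Suc (Poly_Mapping.lookup m' i)) * (s / p i) * form_on_monomials d N p s n' m'"
      using * Suc.IH[OF i(2)] by (simp add: m lookup_add)
    also have "\<dots> = form_on_monomials d (Suc N) p s n m"
      unfolding form_on_monomials_def m i(3) mfact_add_single[OF i(1)] mpow_add_single[OF i(1)]
      by (simp add: ac_simps)
    finally show ?thesis .
  next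
    case False
    \<comment> \<open>The new variable \<open>i\<close> occurs in \<open>n\<close> but not in
      \<open>m\<close>, and the derivative carries the exponent of \<open>i\<close> in
      \<open>m\<close>, here 0, as a factor.\<close>
    hence "n \<noteq> m"
      by (auto simp: i(3) lookup_add)
    thus ?thesis
      using * False by (simp add: form_on_monomials_def)
  qed
qed

section \<open>The Gram matrix of the new variables\<close>

theorem lemma4p1:
  fixes d N :: nat
    and \<nu> \<theta> \<theta>t :: complex
    and P Pt U R :: "complex mat"
    and p pt :: "nat \<Rightarrow> complex"
    and xt :: "nat \<Rightarrow> cpoly"
    and n m :: multi_index
  assumes "d \<ge> 1" and "N \<ge> 1"
    and "(\<nu>, P, Pt, U) \<in> kappa_tuples d"
    and "p = (\<lambda>i. P $$ (i, i))" and "pt = (\<lambda>i. Pt $$ (i, i))"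
    and "R = \<theta>t \<cdot>\<^sub>m (Pt * transpose_mat U)" and "det R = 1"
    and "\<theta> = \<nu> / \<theta>t"
    and "xt = row_transform d R"
    and "n \<in> multi_indices d N" and "m \<in> multi_indices d N"
  shows "form d N pt \<theta> (mpow d xt n) (mpow d xt m)
       = (if n = m then mfact d n / mpow d p n * \<theta>t ^ N else 0)"
proof -
  note K = assms(3)[unfolded kappa_tuples_def, simplified]
  have carr: "P \<in> carrier_mat (Suc d) (Suc d)" "Pt \<in> carrier_mat (Suc d) (Suc d)"
      "U \<in> carrier_mat (Suc d) (Suc d)"
    and diag: "diagonal_mat P" "diagonal_mat Pt"
    and id: "\<nu> \<cdot>\<^sub>m (P * U * Pt * transpose_mat U) = 1\<^sub>m (Suc d)"
    using K by auto
  have diag_mult: "(D * A) $$ (i, j) = D $$ (i, i) * A $$ (i, j)"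
    if "diagonal_mat D" "D \<in> carrier_mat (Suc d) (Suc d)" "A \<in> carrier_mat (Suc d) (Suc d)"
      "i \<le> d" "j \<le> d" for D A :: "complex mat" and i j
  proof -
    have "(D * A) $$ (i, j) = (\<Sum>k = 0..<Suc d. D $$ (i, k) * A $$ (k, j))"
      using that by (simp add: scalar_prod_def)
    also have "\<dots> = (\<Sum>k = 0..<Suc d. if k = i then D $$ (i, i) * A $$ (i, j) else 0)"
      using that by (intro sum.cong) (auto simp: diagonal_mat_def)
    finally show ?thesis
      using that by simp
  qed
  have R: "R $$ (k, i) = \<theta>t * pt k * U $$ (i, k)" if "k \<le> d" "i \<le> d" for k i
    using that carr diag by (simp add: assms(5,6) diag_mult del: index_mult_mat(1))
  \<comment> \<open>The matrix relation read entrywise: the rows of \<open>U\<close> are orthogonal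
    with respect to the weights \<open>pt\<close>.\<close>
  have gram_P: "\<nu> * (p i * (\<Sum>k\<le>d. U $$ (i, k) * pt k * U $$ (j, k))) = (if i = j then 1 else 0)"
    if "i \<le> d" "j \<le> d" for i j
  proof -
    \<comment> \<open>Nested to the right, both diagonal matrices are left factors, as
      \<open>diag_mult\<close> requires.\<close>
    have assoc: "P * U * Pt * transpose_mat U = P * (U * (Pt * transpose_mat U))"
      using carr by (simp add: assoc_mult_mat[of _ "Suc d" "Suc d" _ "Suc d" _ "Suc d"])
    have "(\<nu> \<cdot>\<^sub>m (P * U * Pt * transpose_mat U)) $$ (i, j)
        = \<nu> * (p i * (U * (Pt * transpose_mat U)) $$ (i, j))"
      unfolding assoc using that carr diag
      by (simp add: assms(4) diag_mult del: index_mult_mat(1))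
    also have "(U * (Pt * transpose_mat U)) $$ (i, j)
        = (\<Sum>k = 0..<Suc d. U $$ (i, k) * (Pt * transpose_mat U) $$ (k, j))"
      using that carr by (simp add: scalar_prod_def)
    also have "\<dots> = (\<Sum>k\<le>d. U $$ (i, k) * pt k * U $$ (j, k))"
      unfolding atLeast0LessThan lessThan_Suc_atMost
      using that carr diag by (intro sum.cong) (simp_all add: assms(5) diag_mult del: index_mult_mat(1))
    finally show ?thesis
      using that by (simp add: id)
  qed
  have gram: "(\<Sum>k\<le>d. \<theta> / pt k * R $$ (k, i) * R $$ (k, j)) = (if j = i then \<theta>t / p i else 0)"
    if "i \<le> d" "j \<le> d" for i j
  proof -
    have "(\<Sum>k\<le>d. \<theta> / pt k * R $$ (k, i) * R $$ (k, j))
        = (\<Sum>k\<le>d. \<theta>t * (\<nu> * (U $$ (i, k) * pt k * U $$ (j, k))))"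
      \<comment> \<open>With \<open>\<theta> = \<nu> / \<theta>t\<close>, one factor
        \<open>\<theta>t\<close> and one factor \<open>pt k\<close> cancel; were either of them 0,
        both sides would be 0.\<close>
      using that by (intro sum.cong refl) (simp add: R assms(8))
    also have "\<dots> = \<theta>t * (\<nu> * (\<Sum>k\<le>d. U $$ (i, k) * pt k * U $$ (j, k)))"
      by (simp only: sum_distrib_left)
    also have "\<dots> = (if j = i then \<theta>t / p i else 0)"
    proof -
      \<comment> \<open>The diagonal case of \<open>gram_P\<close> has right-hand side 1 and
        contains the factor \<open>p i\<close>.\<close>
      have "p i \<noteq> 0"
        using gram_P[OF that(1) that(1)] by auto
      hence "\<nu> * (\<Sum>k\<le>d. U $$ (i, k) * pt k * U $$ (j, k)) = (if i = j then 1 else 0) / p i"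
        using gram_P[OF that] by (simp only: eq_divide_eq ac_simps if_False if_True not_False_eq_True)
      thus ?thesis
        by simp
    qed
    finally show ?thesis .
  qed
  show ?thesis
    using form_mpow_row_transform[of d \<theta> pt R \<theta>t p, OF gram assms(10,11)]
    by (simp add: assms(9) form_on_monomials_def)
qed

end
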